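(* Let $A$ be a $k\times k$ complex matrix and let $\chi_A(x)=(x-\alpha_1)^{m_1}(x-\alpha_2)^{m_2}\cdots(x-\alpha_s)^{m_s}$ be its characteristic polynomial, where $\alpha_1,\ldots,\alpha_s$ are distinct complex numbers, $\alpha_1=0$, $m_1\ge 0$ (possibly $m_1=0$), and $m_j\ge 1$ for $j\ge 2$. Put $B_{ir}=L_{ir}(A)[\chi_A]$. Then: 1. For each $i$ with $m_i\ge1$, the index of $\alpha_i$ is the greatest integer $j\ge 1$ such that $B_{i,j-1}\neq 0$. 2. For each $i$ with $m_i\ge1$, the index of $\alpha_i$ is $1$ if and only if $B_{i1}=0$. 3. $A$ is diagonalizable if and only if $B_{i1}=0$ for all $i=1,2,\ldots,s$. 4. For every positive integer $n$, $$A_D^{n}=\sum_{j=0}^{m_2-1}\binom{-n}{j}\alpha_2^{-n-j}B_{2j}+\cdots+\sum_{j=0}^{m_s-1}\binom{-n}{j}\alpha_s^{-n-j}B_{sj},$$ where $A_D$ denotes the Drazin inverse of $A$.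
   Context: For a non-constant polynomial $P(x)=(x-\alpha_1)^{m_1}\cdots(x-\alpha_s)^{m_s}$ with $\alpha_1,\ldots,\alpha_s\in\mathbb{C}$ distinct and $m_1,\ldots,m_s$ nonnegative integers, set, for $1\le j\le s$, $P_j(x)=\prod_{i\ne j}(x-\alpha_i)^{m_i}=P(x)/(x-\alpha_j)^{m_j}$ and $g_j(x)=1/P_j(x)$. For $1\le j\le s$ and $r\ge 0$ define the polynomial $$L_{jr}(x)[P]=P_j(x)(x-\alpha_j)^{r}\sum_{i=0}^{m_j-1-r}\frac{1}{i!}g_j^{(i)}(\alpha_j)(x-\alpha_j)^i,$$ where an empty sum is zero (so $L_{jr}(x)[P]=0$ when $r\ge m_j$). $L_{jr}(A)[P]$ denotes the evaluation of this polynomial at the matrix $A$. The index of an eigenvalue $\alpha$ of $A$ is the smallest integer $r\ge 1$ with $\ker(A-\alpha I)^r=\ker(A-\alpha I)^{r+1}$ (equivalently, the multiplicity of $\alpha$ as a root of the minimal polynomial of $A$). $\binom{-n}{j}=\frac{(-n)(-n-1)\cdots(-n-j+1)}{j!}$, with $\binom{-n}{0}=1$. The Drazin inverse $A_D$ of $A$ is the unique matrix $X$ with $AX=XA$, $XAX=X$ and $A^{l+1}X=A^{l}$ for some integer $l\ge 0$. *)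

theory Defs
  imports
    "HOL-Analysis.Derivative"
    "Jordan_Normal_Form.Char_Poly"
    "Jordan_Normal_Form.Matrix_Kernel"
begin

definition poly_mat :: "'a::comm_ring_1 poly \<Rightarrow> 'a mat \<Rightarrow> 'a mat" where
  "poly_mat p A =
     (\<Oplus>\<^bsub>module_mat TYPE('a) (dim_row A) (dim_row A)\<^esub>i\<in>{..degree p}. coeff p i \<cdot>\<^sub>m (A ^\<^sub>m i))"

text \<open>
  In the next three definitions \<open>s\<close>, \<open>\<alpha>\<close>, \<open>m\<close> stand for the factored polynomial
  \<open>P = (\<Prod>i=1..s. [:- \<alpha> i, 1:] ^ m i)\<close>, where \<open>\<alpha> 1, \<dots>, \<alpha> s\<close> are meant to be distinct.
\<close>

definition cofactor_poly :: "nat \<Rightarrow> (nat \<Rightarrow> 'a::comm_ring_1) \<Rightarrow> (nat \<Rightarrow> nat) \<Rightarrow> nat \<Rightarrow> 'a poly" where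
  "cofactor_poly s \<alpha> m j = (\<Prod>i\<in>{1..s} - {j}. [:- \<alpha> i, 1:] ^ m i)"

definition cofactor_inverse :: "nat \<Rightarrow> (nat \<Rightarrow> complex) \<Rightarrow> (nat \<Rightarrow> nat) \<Rightarrow> nat \<Rightarrow> complex \<Rightarrow> complex" where
  "cofactor_inverse s \<alpha> m j x = 1 / poly (cofactor_poly s \<alpha> m j) x"

text \<open>
  The polynomial \<open>L\<^sub>j\<^sub>r\<close>. The upper summation limit \<open>m j - 1 - r\<close> (an integer) is written as
  \<open>i < m j - r\<close> with truncated subtraction, so the sum is empty exactly when \<open>r \<ge> m j\<close>.
\<close>

definition L_poly :: "nat \<Rightarrow> (nat \<Rightarrow> complex) \<Rightarrow> (nat \<Rightarrow> nat) \<Rightarrow> nat \<Rightarrow> nat \<Rightarrow> complex poly" where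
  "L_poly s \<alpha> m j r =
     cofactor_poly s \<alpha> m j * [:- \<alpha> j, 1:] ^ r *
     (\<Sum>i<m j - r. Polynomial.smult (1 / fact i * (deriv ^^ i) (cofactor_inverse s \<alpha> m j) (\<alpha> j))
                                    ([:- \<alpha> j, 1:] ^ i))"

text \<open>Here \<open>char_matrix A a\<close> is \<open>A - a I\<close>.\<close>

definition eigenvalue_index :: "'a::field mat \<Rightarrow> 'a \<Rightarrow> nat" where
  "eigenvalue_index A a =
     (LEAST r. r \<ge> 1 \<and> mat_kernel (char_matrix A a ^\<^sub>m r) = mat_kernel (char_matrix A a ^\<^sub>m (r + 1)))"

definition diagonalizable_mat :: "'a::field mat \<Rightarrow> bool" where
  "diagonalizable_mat A \<longleftrightarrow> (\<exists>D. diagonal_mat D \<and> similar_mat A D)"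

definition is_drazin_inverse :: "'a::field mat \<Rightarrow> 'a mat \<Rightarrow> bool" where
  "is_drazin_inverse A X \<longleftrightarrow>
     X \<in> carrier_mat (dim_row A) (dim_row A) \<and>
     A * X = X * A \<and> X * A * X = X \<and> (\<exists>l. A ^\<^sub>m (l + 1) * X = A ^\<^sub>m l)"

definition drazin_inverse :: "'a::field mat \<Rightarrow> 'a mat" where
  "drazin_inverse A = (THE X. is_drazin_inverse A X)"

end

theory Submission
  imports
    Defs
    "HOL-Analysis.FPS_Convergence"
    "HOL-Computational_Algebra.Field_as_Ring"
    "HOL-Number_Theory.Cong"
    "Jordan_Normal_Form.Jordan_Normal_Form_Existence"
    "Jordan_Normal_Form.Jordan_Normal_Form_Uniqueness"
begin

text \<open>
  Everything happens in the ring of polynomials modulo \<open>\<chi>\<^sub>A\<close>. By Cayley--Hamilton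
  (\<open>cayley_hamilton\<close>), evaluation at \<open>A\<close> is a ring homomorphism that factors through this
  quotient, and since the \<open>(x - \<alpha>\<^sub>i)\<^bsup>m\<^sub>i\<^esup>\<close> are pairwise coprime, a congruence modulo \<open>\<chi>\<^sub>A\<close> may be
  checked modulo each of them (\<open>cong_P_if_cong_local\<close>). Write \<open>u\<^sub>i = x - \<alpha>\<^sub>i\<close>.

  The sum in the definition of \<open>L\<^sub>i\<^sub>r\<close> is a truncated Taylor series of \<open>1/P\<^sub>i\<close>, so it inverts
  \<open>P\<^sub>i\<close> modulo a power of \<open>u\<^sub>i\<close>. Hence \<open>L\<^sub>i\<^sub>r \<equiv> u\<^sub>i\<^sup>r\<close> modulo \<open>u\<^sub>i\<^bsup>m\<^sub>i\<^esup>\<close>, while \<open>L\<^sub>i\<^sub>r \<equiv> 0\<close>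
  modulo the other prime powers (\<open>L_cong_self\<close>, \<open>L_cong_other\<close>). In other words \<open>L\<^sub>i\<^sub>0(A)\<close> is the
  projection onto the generalized eigenspace of \<open>\<alpha>\<^sub>i\<close>, and \<open>L\<^sub>i\<^sub>r(A) = (A - \<alpha>\<^sub>i)\<^sup>r L\<^sub>i\<^sub>0(A)\<close>.

  Indices: \<open>(A - \<alpha>\<^sub>i)\<^sup>r\<close> kills the image of that projection exactly when \<open>(A - \<alpha>\<^sub>i)\<^sup>r\<close> and
  \<open>(A - \<alpha>\<^sub>i)\<^bsup>r+1\<^esup>\<close> have the same kernel (\<open>mat_kernel_stable_iff\<close>). So \<open>B\<^sub>i\<^sub>r = 0\<close> if and only if
  \<open>r\<close> is at least the index of \<open>\<alpha>\<^sub>i\<close> (\<open>poly_mat_L_eq_0_iff\<close>), which gives the first two claims.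

  Diagonalizability: for the third claim it remains to see that \<open>A\<close> is diagonalizable if and only
  if \<open>A - a I\<close> and its square have the same kernel for all eigenvalues \<open>a\<close>. For a diagonal matrix
  this is immediate; conversely a Jordan block of size at least two would make the second kernel
  larger.

  Drazin inverse: let \<open>drazin_poly n\<close> be the polynomial whose value at \<open>A\<close> is the claimed formula
  for \<open>A\<^sub>D\<^sup>n\<close>. Modulo \<open>u\<^sub>i\<^bsup>m\<^sub>i\<^esup>\<close> with \<open>i \<ge> 2\<close> it is the truncated Taylor series of \<open>x\<^bsup>-n\<^esup>\<close> at
  \<open>\<alpha>\<^sub>i\<close>, so it inverts \<open>x\<^sup>n\<close> there, and modulo \<open>x\<^bsup>m\<^sub>1\<^esup>\<close> it vanishes. From this description one reads
  off modulo each prime power that \<open>drazin_poly 1\<close> gives a Drazin inverse, and that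
  \<open>drazin_poly n\<close> is the \<open>n\<close>-th power of \<open>drazin_poly 1\<close>.
\<close>

section \<open>Truncated Taylor expansions as inverses modulo a power of a linear polynomial\<close>

text \<open>
  Both the expansion of \<open>1/P\<^sub>j\<close> inside \<open>L\<^sub>j\<^sub>r\<close> and the binomial series of \<open>x\<^bsup>-n\<^esup>\<close> are instances:
  after moving the centre \<open>a\<close> to the origin, congruence modulo \<open>x\<^sup>m\<close> only sees the first \<open>m\<close>
  coefficients, and on those a truncated series agrees with the full one.
\<close>

lemma cong_one_if_fps_inverse:
  fixes p :: "complex poly"
  assumes "fps_of_poly (pcompose p [:a, 1:]) * Abs_fps c = 1"
  shows "[p * (\<Sum>i<m. Polynomial.smult (c i) ([:- a, 1:] ^ i)) = 1] (mod [:- a, 1:] ^ m)"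
proof -
  define q where "q = pcompose p [:a, 1:]"
  define t where "t = (\<Sum>i<m. monom (c i) i)"
  have coeff_t: "coeff t i = (if i < m then c i else 0)" for i
    by (simp add: t_def coeff_sum)
  have "coeff (q * t - 1) l = 0" if "l < m" for l
  proof -
    have "coeff (q * t) l = (\<Sum>i\<le>l. coeff q i * c (l - i))"
      unfolding coeff_mult by (rule sum.cong) (use that in \<open>auto simp: coeff_t\<close>)
    also have "\<dots> = fps_nth (fps_of_poly q * Abs_fps c) l"
      by (simp add: fps_mult_nth atMost_atLeast0)
    also have "\<dots> = coeff 1 l"
      using assms by (simp add: q_def coeff_1)
    finally show ?thesis by simp
  qed
  hence "monom 1 m dvd q * t - 1"
    by (simp add: monom_1_dvd_iff')
  then obtain w where w: "q * t - 1 = monom 1 m * w" ..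
  have shift_monom: "pcompose (monom b i) [:- a, 1:] = Polynomial.smult b ([:- a, 1:] ^ i)" for b i
    by (induction i) (simp_all add: monom_0 monom_Suc pcompose_pCons)
  have "pcompose q [:- a, 1:] = p"
    by (simp add: q_def pcompose_assoc[symmetric] pcompose_pCons)
  moreover have "pcompose t [:- a, 1:] = (\<Sum>i<m. Polynomial.smult (c i) ([:- a, 1:] ^ i))"
    by (simp add: t_def pcompose_sum shift_monom)
  ultimately have "p * (\<Sum>i<m. Polynomial.smult (c i) ([:- a, 1:] ^ i)) - 1
      = [:- a, 1:] ^ m * pcompose w [:- a, 1:]"
    using arg_cong[OF w, of "\<lambda>f. pcompose f [:- a, 1:]"]
    by (simp add: pcompose_diff pcompose_mult pcompose_1 shift_monom)
  thus ?thesis by (simp add: cong_iff_dvd_diff)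
qed

lemma has_fps_expansion_poly:
  "poly p has_fps_expansion fps_of_poly p" for p :: "complex poly"
proof (induction p)
  case (pCons b p)
  have "(\<lambda>x. b + poly p x * x) has_fps_expansion fps_const b + fps_of_poly p * fps_X"
    by (intro fps_expansion_intros pCons)
  thus ?case by (simp add: fps_of_poly_pCons poly_pCons[abs_def] mult.commute)
qed (simp add: poly_0[abs_def])

text \<open>
  The Taylor coefficients of \<open>1/p\<close> at \<open>a\<close> are those of the reciprocal of the power series of
  \<open>p(a + x)\<close>, because reciprocals of power series are compatible with reciprocals of functions.
\<close>

lemma taylor_reciprocal_cong:
  fixes p :: "complex poly"
  assumes "poly p a \<noteq> 0"
  shows "[p * (\<Sum>i<m. Polynomial.smult (1 / fact i * (deriv ^^ i) (\<lambda>x. 1 / poly p x) a)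
           ([:- a, 1:] ^ i)) = 1] (mod [:- a, 1:] ^ m)"
proof (rule cong_one_if_fps_inverse)
  let ?q = "pcompose p [:a, 1:]"
  have nz: "fps_nth (fps_of_poly ?q) 0 \<noteq> 0"
    using assms by simp
  have "(\<lambda>x. inverse (poly ?q x)) has_fps_expansion inverse (fps_of_poly ?q)"
    by (intro has_fps_expansion_inverse has_fps_expansion_poly nz)
  hence "fps_nth (inverse (fps_of_poly ?q)) i
      = 1 / fact i * (deriv ^^ i) (\<lambda>x. 1 / poly p x) a" for i
    by (subst higher_deriv_shift_0)
      (simp add: fps_nth_fps_expansion poly_pcompose o_def inverse_eq_divide)
  hence "Abs_fps (\<lambda>i. 1 / fact i * (deriv ^^ i) (\<lambda>x. 1 / poly p x) a)
      = inverse (fps_of_poly ?q)"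
    by (simp add: fps_eq_iff)
  thus "fps_of_poly ?q * Abs_fps (\<lambda>i. 1 / fact i * (deriv ^^ i) (\<lambda>x. 1 / poly p x) a) = 1"
    using inverse_mult_eq_1'[OF nz] by simp
qed

text \<open>
  Here the inverse series is \<open>(a + x)\<^bsup>-n\<^esup>\<close>; that its product with \<open>(a + x)\<^sup>n\<close> is \<open>1\<close> is Vandermonde's
  identity for the upper arguments \<open>n\<close> and \<open>-n\<close>.
\<close>

lemma neg_binomial_cong:
  fixes a :: complex
  assumes "a \<noteq> 0"
  shows "[[:0, 1:] ^ n * (\<Sum>j<m. Polynomial.smult
            (((- of_nat n) gchoose j) * a powi (- int n - int j)) ([:- a, 1:] ^ j)) = 1]
         (mod [:- a, 1:] ^ m)"
proof (rule cong_one_if_fps_inverse, rule fps_ext)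
  fix r
  let ?c = "\<lambda>j. ((- of_nat n) gchoose j) * a powi (- int n - int j)"
  have coeff: "coeff ([:a, 1:] ^ n) i * a ^ i = of_nat (n choose i) * a ^ n" for i
    by (cases "i \<le> n")
      (simp_all add: coeff_linear_poly_power power_add[symmetric] coeff_eq_0 degree_linear_power)
  have c: "?c j * a ^ n * a ^ j = (- of_nat n) gchoose j" for j
    using assms by (simp add: power_int_diff power_int_minus field_simps)
  \<comment> \<open>multiplying by \<open>a ^ (n + r)\<close> clears all powers of \<open>a\<close> from the convolution\<close>
  have "fps_nth (fps_of_poly (pcompose ([:0, 1:] ^ n) [:a, 1:]) * Abs_fps ?c) r * a ^ (n + r)
      = (\<Sum>i=0..r. coeff ([:a, 1:] ^ n) i * ?c (r - i) * a ^ (n + r))"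
    by (simp add: fps_mult_nth pcompose_hom.hom_power pcompose_pCons sum_distrib_right)
  also have "\<dots> = (\<Sum>i=0..r. a ^ n * (of_nat n gchoose i) * ((- of_nat n) gchoose (r - i)))"
  proof (rule sum.cong)
    fix i assume "i \<in> {0..r}"
    hence "a ^ (n + r) = a ^ n * (a ^ i * a ^ (r - i))"
      by (simp add: power_add[symmetric])
    hence "coeff ([:a, 1:] ^ n) i * ?c (r - i) * a ^ (n + r)
        = (coeff ([:a, 1:] ^ n) i * a ^ i) * (?c (r - i) * a ^ n * a ^ (r - i))"
      by simp
    thus "coeff ([:a, 1:] ^ n) i * ?c (r - i) * a ^ (n + r)
        = a ^ n * (of_nat n gchoose i) * ((- of_nat n) gchoose (r - i))"
      by (simp only: coeff c) (simp add: binomial_gbinomial)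
  qed simp
  also have "\<dots> = a ^ n * ((of_nat n + (- of_nat n)) gchoose r)"
    by (simp only: gbinomial_Vandermonde[symmetric] sum_distrib_left mult.assoc)
  also have "\<dots> = fps_nth 1 r * a ^ (n + r)"
    by (cases r) simp_all
  finally show "fps_nth (fps_of_poly (pcompose ([:0, 1:] ^ n) [:a, 1:]) * Abs_fps ?c) r
      = fps_nth 1 r"
    using assms by simp
qed

lemma coprime_linear_polys:
  fixes a b :: complex
  assumes "a \<noteq> b"
  shows "coprime [:- a, 1:] [:- b, 1:]"
proof (rule coprimeI)
  fix d assume "d dvd [:- a, 1:]" "d dvd [:- b, 1:]"
  hence "d dvd [:- a, 1:] - [:- b, 1:]" by (rule dvd_diff)
  moreover have "is_unit ([:- a, 1:] - [:- b, 1:])"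
    using assms by (simp add: is_unit_pCons_iff)
  ultimately show "is_unit d" by (rule dvd_trans)
qed

section \<open>Evaluating polynomials at a square matrix\<close>

lemma
  assumes "finite F" "\<And>i. i \<in> F \<Longrightarrow> f i \<in> carrier_mat nr nc"
  shows finsum_mat_carrier:
      "(\<Oplus>\<^bsub>module_mat TYPE('a::comm_ring_1) nr nc\<^esub>i\<in>F. f i) \<in> carrier_mat nr nc"
    and index_finsum_mat: "a < nr \<Longrightarrow> b < nc \<Longrightarrow>
      (\<Oplus>\<^bsub>module_mat TYPE('a) nr nc\<^esub>i\<in>F. f i) $$ (a, b) = (\<Sum>i\<in>F. f i $$ (a, b))"
proof -
  interpret abelian_group "module_mat TYPE('a) nr nc"
    by (rule abelian_group_mat)
  have "(\<Oplus>\<^bsub>module_mat TYPE('a) nr nc\<^esub>i\<in>F. f i) \<in> carrier_mat nr nc \<and>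
      (\<forall>a<nr. \<forall>b<nc. (\<Oplus>\<^bsub>module_mat TYPE('a) nr nc\<^esub>i\<in>F. f i) $$ (a, b)
          = (\<Sum>i\<in>F. f i $$ (a, b)))"
    using assms
  proof (induction F rule: finite_induct)
    case empty
    thus ?case by (simp add: module_mat_simps)
  next
    case (insert x F)
    have "f \<in> F \<rightarrow> carrier (module_mat TYPE('a) nr nc)"
      and "f x \<in> carrier (module_mat TYPE('a) nr nc)"
      using insert.prems by (auto simp: module_mat_simps)
    with insert show ?case
      by (auto simp: finsum_insert module_mat_simps)
  qed
  thus "(\<Oplus>\<^bsub>module_mat TYPE('a) nr nc\<^esub>i\<in>F. f i) \<in> carrier_mat nr nc"
    and "a < nr \<Longrightarrow> b < nc \<Longrightarrow>
      (\<Oplus>\<^bsub>module_mat TYPE('a) nr nc\<^esub>i\<in>F. f i) $$ (a, b) = (\<Sum>i\<in>F. f i $$ (a, b))"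
    by auto
qed

locale square_matrix =
  fixes A :: "'a::comm_ring_1 mat" and k :: nat
  assumes carrier_A [simp]: "A \<in> carrier_mat k k"
begin

lemma dim_A [simp]: "dim_row A = k" "dim_col A = k"
  using carrier_A by (metis carrier_matD)+

abbreviation Z :: "'a poly \<Rightarrow> 'a mat" where
  "Z p \<equiv> poly_mat p A"

lemma poly_mat_carrier [simp]: "Z p \<in> carrier_mat k k"
  unfolding poly_mat_def dim_A by (intro finsum_mat_carrier) auto

lemma poly_mat_dim [simp]: "dim_row (Z p) = k" "dim_col (Z p) = k"
  using poly_mat_carrier by (metis carrier_matD)+

lemma index_poly_mat:
  assumes "degree p \<le> N" "a < k" "b < k"
  shows "Z p $$ (a, b) = (\<Sum>i\<le>N. coeff p i * (A ^\<^sub>m i) $$ (a, b))"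
proof -
  have "Z p $$ (a, b) = (\<Sum>i\<le>degree p. (coeff p i \<cdot>\<^sub>m A ^\<^sub>m i) $$ (a, b))"
    unfolding poly_mat_def dim_A using assms by (subst index_finsum_mat) auto
  also have "\<dots> = (\<Sum>i\<le>degree p. coeff p i * (A ^\<^sub>m i) $$ (a, b))"
    using assms by (intro sum.cong) auto
  also have "\<dots> = (\<Sum>i\<le>N. coeff p i * (A ^\<^sub>m i) $$ (a, b))"
    using assms by (intro sum.mono_neutral_left) (auto simp: coeff_eq_0)
  finally show ?thesis .
qed

lemma poly_mat_0 [simp]: "Z 0 = 0\<^sub>m k k"
  by (rule eq_matI) (simp_all add: index_poly_mat[of _ 0])

lemma poly_mat_1 [simp]: "Z 1 = 1\<^sub>m k"
  by (rule eq_matI) (simp_all add: index_poly_mat[of _ 0])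

lemma poly_mat_add: "Z (p + q) = Z p + Z q"
  by (rule eq_matI)
    (simp_all add: index_poly_mat[of _ "max (degree p) (degree q)"] degree_add_le
      algebra_simps sum.distrib)

lemma poly_mat_smult: "Z (Polynomial.smult c p) = c \<cdot>\<^sub>m Z p"
  by (rule eq_matI)
    (simp_all add: index_poly_mat[of _ "degree p"] degree_smult_le sum_distrib_left mult.assoc)

lemma pow_mat_commute: "A * A ^\<^sub>m i = A ^\<^sub>m i * A"
proof (induction i)
  case (Suc i)
  thus ?case
    by (simp add: assoc_mult_mat[of A k k _ k _ k, symmetric])
qed auto

lemma poly_mat_X_mult: "Z (pCons 0 p) = A * Z p"
proof (rule eq_matI)
  fix a b assume "a < dim_row (A * Z p)" "b < dim_col (A * Z p)"
  hence ab: "a < k" "b < k" by auto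
  have "Z (pCons 0 p) $$ (a, b) = (\<Sum>i\<le>Suc (degree p). coeff (pCons 0 p) i * (A ^\<^sub>m i) $$ (a, b))"
    by (rule index_poly_mat) (use ab in \<open>auto intro: degree_pCons_le\<close>)
  also have "\<dots> = (\<Sum>i\<le>degree p. coeff p i * (A * A ^\<^sub>m i) $$ (a, b))"
    by (simp add: sum.atMost_Suc_shift pow_mat_commute del: sum.atMost_Suc)
  also have "\<dots> = (\<Sum>i\<le>degree p. coeff p i * (\<Sum>l<k. A $$ (a, l) * (A ^\<^sub>m i) $$ (l, b)))"
    using ab by (intro sum.cong) (auto simp: scalar_prod_def atLeast0LessThan)
  also have "\<dots> = (\<Sum>l<k. A $$ (a, l) * (\<Sum>i\<le>degree p. coeff p i * (A ^\<^sub>m i) $$ (l, b)))"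
    unfolding sum_distrib_left by (subst sum.swap) (simp add: mult_ac)
  also have "\<dots> = (A * Z p) $$ (a, b)"
    using ab
    by (auto simp: scalar_prod_def atLeast0LessThan index_poly_mat[of p "degree p"])
  finally show "Z (pCons 0 p) $$ (a, b) = (A * Z p) $$ (a, b)" .
qed auto

lemma poly_mat_pCons: "Z (pCons c p) = c \<cdot>\<^sub>m 1\<^sub>m k + A * Z p"
proof -
  have "pCons c p = Polynomial.smult c 1 + pCons 0 p" by simp
  thus ?thesis by (simp only: poly_mat_add poly_mat_smult poly_mat_1 poly_mat_X_mult)
qed

lemma poly_mat_const: "Z [:c:] = c \<cdot>\<^sub>m 1\<^sub>m k"
  by (simp add: poly_mat_pCons)

lemma poly_mat_mult: "Z (p * q) = Z p * Z q"
proof (induction p)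
  case 0
  show ?case by simp
next
  case (pCons c p)
  have "Z (pCons c p * q) = c \<cdot>\<^sub>m Z q + A * (Z p * Z q)"
    by (simp add: poly_mat_add poly_mat_smult poly_mat_X_mult pCons.IH)
  also have "\<dots> = (c \<cdot>\<^sub>m 1\<^sub>m k + A * Z p) * Z q"
    by (subst add_mult_distrib_mat[of _ k k _ _ k])
      (auto simp: assoc_mult_mat[of A k k _ k _ k] mult_smult_assoc_mat[of _ k k _ k])
  finally show ?case by (simp add: poly_mat_pCons)
qed

lemma poly_mat_power: "Z (p ^ n) = Z p ^\<^sub>m n"
  by (induction n) (simp_all add: poly_mat_mult power_Suc2 del: power_Suc)

lemma poly_mat_X: "Z [:0, 1:] = A"
proof -
  have "Z [:0, 1:] = A * Z 1"
    by (simp add: poly_mat_X_mult[symmetric] one_pCons)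
  thus ?thesis by simp
qed

lemma index_poly_mat_sum:
  assumes "a < k" "b < k"
  shows "Z (\<Sum>i\<in>F. f i) $$ (a, b) = (\<Sum>i\<in>F. Z (f i) $$ (a, b))"
  by (induction F rule: infinite_finite_induct) (use assms in \<open>simp_all add: poly_mat_add\<close>)

lemma poly_mat_sum:
  assumes "finite F"
  shows "Z (\<Sum>i\<in>F. f i) = (\<Oplus>\<^bsub>module_mat TYPE('a) k k\<^esub>i\<in>F. Z (f i))"
  using finsum_mat_carrier[OF assms, of "\<lambda>i. Z (f i)" k k]
  by (intro eq_matI) (simp_all add: index_finsum_mat[OF assms] index_poly_mat_sum)

text \<open>
  Let \<open>M = x I - A\<close> and let \<open>N\<close> be its adjugate, so that \<open>M N = \<chi>\<^sub>A I\<close>. When the entries of \<open>M\<close> are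
  evaluated at \<open>A\<close> and act on the unit vectors \<open>e\<^sub>j\<close>, the sum over a column is
  \<open>\<Sum>\<^sub>j M\<^sub>j\<^sub>i(A) e\<^sub>j = A e\<^sub>i - \<Sum>\<^sub>j A\<^sub>j\<^sub>i e\<^sub>j = 0\<close>. Applying \<open>N\<^sub>i\<^sub>l(A)\<close> and summing over \<open>i\<close> gives
  \<open>\<chi>\<^sub>A(A) e\<^sub>l = 0\<close>.
\<close>

theorem cayley_hamilton: "Z (char_poly A) = 0\<^sub>m k k"
proof (rule eq_matI)
  fix a l assume "a < dim_row (0\<^sub>m k k)" "l < dim_col (0\<^sub>m k k)"
  hence al: "a < k" "l < k" by auto
  define M where "M = char_poly_matrix A"
  define N where "N = adj_mat M"
  have M: "M \<in> carrier_mat k k" by (simp add: M_def)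
  have N: "N \<in> carrier_mat k k" and MN: "M * N = char_poly A \<cdot>\<^sub>m 1\<^sub>m k"
    using adj_mat[OF M] by (simp_all add: N_def char_poly_def M_def)
  have ZM: "Z (M $$ (j, i)) $$ (b, j) =
      (if i = j then A $$ (b, i) else 0) - (if b = j then A $$ (j, i) else 0)"
    if "i < k" "j < k" "b < k" for i j b
  proof -
    have "M $$ (j, i) = (if i = j then [:0, 1:] else 0) + [:- A $$ (j, i):]"
      using that by (auto simp: M_def char_poly_matrix_def)
    thus ?thesis
      using that by (simp add: poly_mat_add poly_mat_const poly_mat_X)
  qed
  have MN_index: "(\<Sum>i<k. M $$ (j, i) * N $$ (i, l)) = (if j = l then char_poly A else 0)"
    if "j < k" for j
    using arg_cong[OF MN, of "\<lambda>B. B $$ (j, l)"] that al M N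
    by (simp add: scalar_prod_def atLeast0LessThan)
  have "Z (char_poly A) $$ (a, l)
      = (\<Sum>j<k. Z (if j = l then char_poly A else 0) $$ (a, j))"
    using al by (subst sum.remove[of _ l]) (auto intro!: sum.neutral)
  also have "\<dots> = (\<Sum>j<k. \<Sum>i<k. Z (N $$ (i, l) * M $$ (j, i)) $$ (a, j))"
    by (rule sum.cong)
      (use al in \<open>auto simp: MN_index[symmetric] index_poly_mat_sum mult.commute simp del: if_split\<close>)
  also have "\<dots> = (\<Sum>j<k. \<Sum>i<k. \<Sum>b<k. Z (N $$ (i, l)) $$ (a, b) * Z (M $$ (j, i)) $$ (b, j))"
    using al by (intro sum.cong) (auto simp: poly_mat_mult scalar_prod_def atLeast0LessThan)
  also have "\<dots> = (\<Sum>i<k. \<Sum>b<k. \<Sum>j<k. Z (N $$ (i, l)) $$ (a, b) * Z (M $$ (j, i)) $$ (b, j))"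
    by (subst sum.swap, rule sum.cong[OF refl], rule sum.swap)
  also have "\<dots> = (\<Sum>i<k. \<Sum>b<k. Z (N $$ (i, l)) $$ (a, b) * (\<Sum>j<k. Z (M $$ (j, i)) $$ (b, j)))"
    by (simp add: sum_distrib_left)
  also have "\<dots> = 0"
    by (intro sum.neutral ballI) (simp add: ZM sum_subtractf)
  finally show "Z (char_poly A) $$ (a, l) = 0\<^sub>m k k $$ (a, l)" using al by simp
qed simp_all

end

section \<open>The polynomials \<open>L\<^sub>j\<^sub>r\<close> modulo the prime power factors\<close>

locale factored_poly =
  fixes s :: nat and \<alpha> :: "nat \<Rightarrow> complex" and m :: "nat \<Rightarrow> nat"
  assumes inj: "inj_on \<alpha> {1..s}"
begin

abbreviation u :: "nat \<Rightarrow> complex poly" where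
  "u i \<equiv> [:- \<alpha> i, 1:]"

abbreviation L :: "nat \<Rightarrow> nat \<Rightarrow> complex poly" where
  "L i r \<equiv> L_poly s \<alpha> m i r"

abbreviation P :: "complex poly" where
  "P \<equiv> (\<Prod>i=1..s. u i ^ m i)"

text \<open>
  The uniqueness half of the Chinese remainder theorem.
\<close>

lemma cong_P_if_cong_local:
  assumes "\<And>j. j \<in> {1..s} \<Longrightarrow> [p = q] (mod u j ^ m j)"
  shows "[p = q] (mod P)"
  using assms inj
  by (intro cong_cong_prod_coprime) (auto dest: inj_onD intro!: coprime_linear_polys)

text \<open>
  For \<open>r > m i\<close> the polynomial \<open>L i r\<close> vanishes, and so does \<open>u i ^ r\<close> modulo \<open>u i ^ m i\<close>. Otherwise
  the truncated series inverts the cofactor modulo \<open>u i ^ (m i - r)\<close>, and the factor \<open>u i ^ r\<close>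
  supplies the missing precision.
\<close>

lemma L_cong_self:
  assumes "i \<in> {1..s}"
  shows "[L i r = u i ^ r] (mod u i ^ m i)"
proof (cases "r \<le> m i")
  case True
  let ?p = "cofactor_poly s \<alpha> m i"
  have "poly ?p (\<alpha> i) \<noteq> 0"
    using assms inj by (auto simp: cofactor_poly_def poly_prod dest: inj_onD)
  from taylor_reciprocal_cong[OF this, of "m i - r"]
  have "u i ^ (m i - r) dvd ?p * (\<Sum>l<m i - r. Polynomial.smult
      (1 / fact l * (deriv ^^ l) (cofactor_inverse s \<alpha> m i) (\<alpha> i)) (u i ^ l)) - 1"
    by (simp add: cong_iff_dvd_diff cofactor_inverse_def[abs_def])
  hence "u i ^ r * u i ^ (m i - r) dvd u i ^ r * (?p * (\<Sum>l<m i - r. Polynomial.smult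
      (1 / fact l * (deriv ^^ l) (cofactor_inverse s \<alpha> m i) (\<alpha> i)) (u i ^ l)) - 1)"
    by (rule mult_dvd_mono[OF dvd_refl])
  moreover have "u i ^ r * u i ^ (m i - r) = u i ^ m i"
    using True by (simp add: power_add[symmetric])
  ultimately show ?thesis
    by (simp add: cong_iff_dvd_diff L_poly_def algebra_simps)
next
  case False
  thus ?thesis
    by (simp add: L_poly_def cong_iff_dvd_diff le_imp_power_dvd)
qed

lemma L_cong_other:
  assumes "j \<in> {1..s}" "i \<noteq> j"
  shows "[L i r = 0] (mod u j ^ m j)"
proof -
  have "u j ^ m j dvd cofactor_poly s \<alpha> m i"
    unfolding cofactor_poly_def using assms by (intro dvd_prodI) auto
  thus ?thesis
    by (simp add: cong_0_iff L_poly_def)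
qed

lemma L_cong_power_mult:
  assumes "i \<in> {1..s}"
  shows "[L i r = u i ^ r * L i 0] (mod P)"
proof (rule cong_P_if_cong_local)
  fix j assume j: "j \<in> {1..s}"
  show "[L i r = u i ^ r * L i 0] (mod u j ^ m j)"
  proof (cases "j = i")
    case True
    have "[u i ^ r * L i 0 = u i ^ r * u i ^ 0] (mod u i ^ m i)"
      by (intro cong_mult cong_refl L_cong_self assms)
    with L_cong_self[OF assms, of r] True show ?thesis
      by (auto intro: cong_trans cong_sym)
  next
    case False
    have "[u i ^ r * L i 0 = u i ^ r * 0] (mod u j ^ m j)"
      by (intro cong_mult cong_refl L_cong_other j) (use False in auto)
    with L_cong_other[OF j, of i r] False show ?thesis
      by (auto intro: cong_trans cong_sym)
  qed
qed

text \<open>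
  Evaluated at \<open>A\<close>, this is the right-hand side of the formula for the \<open>n\<close>-th power of the Drazin
  inverse.
\<close>

definition drazin_poly :: "nat \<Rightarrow> complex poly" where
  "drazin_poly n = (\<Sum>i\<in>{2..s}. \<Sum>j\<in>{0..m i - 1}.
     Polynomial.smult (((- of_nat n) gchoose j) * \<alpha> i powi (- int n - int j)) (L i j))"

text \<open>
  Modulo \<open>u i ^ m i\<close> only the summand for \<open>i\<close> survives, and there \<open>L i j\<close> becomes \<open>u i ^ j\<close>. What is left
  is the binomial series of \<open>x\<^bsup>-n\<^esup>\<close> at \<open>\<alpha> i\<close>.
\<close>

lemma drazin_poly_cong_local:
  assumes i: "i \<in> {2..s}" and m: "m i \<ge> 1" and nz: "\<alpha> i \<noteq> 0"
  shows "[[:0, 1:] ^ n * drazin_poly n = 1] (mod u i ^ m i)"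
proof -
  let ?c = "\<lambda>i j. ((- of_nat n) gchoose j) * \<alpha> i powi (- int n - int j)"
  have range: "{0..m i - 1} = {..<m i}" using m by auto
  have "[(\<Sum>i'\<in>{2..s}. \<Sum>j\<in>{0..m i' - 1}. Polynomial.smult (?c i' j) (L i' j))
      = (\<Sum>i'\<in>{2..s}. \<Sum>j\<in>{0..m i' - 1}. if i' = i then Polynomial.smult (?c i j) (u i ^ j) else 0)]
      (mod u i ^ m i)"
  proof (intro cong_sum)
    fix i' j assume "i' \<in> {2..s}"
    hence "[L i' j = (if i' = i then u i ^ j else 0)] (mod u i ^ m i)"
      using i by (auto intro!: L_cong_self L_cong_other)
    from cong_mult[OF cong_refl this, of "[:?c i' j:]"]
    show "[Polynomial.smult (?c i' j) (L i' j)
        = (if i' = i then Polynomial.smult (?c i j) (u i ^ j) else 0)] (mod u i ^ m i)"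
      by (cases "i' = i") auto
  qed
  also have "(\<Sum>i'\<in>{2..s}. \<Sum>j\<in>{0..m i' - 1}. if i' = i then Polynomial.smult (?c i j) (u i ^ j) else 0)
      = (\<Sum>i'\<in>{2..s}. if i' = i then \<Sum>j\<in>{0..m i - 1}. Polynomial.smult (?c i j) (u i ^ j) else 0)"
    by (intro sum.cong) auto
  also have "\<dots> = (\<Sum>j<m i. Polynomial.smult (?c i j) (u i ^ j))"
    unfolding range using i by simp
  finally have "[[:0, 1:] ^ n * drazin_poly n
      = [:0, 1:] ^ n * (\<Sum>j<m i. Polynomial.smult (?c i j) (u i ^ j))] (mod u i ^ m i)"
    unfolding drazin_poly_def by (rule cong_mult[OF cong_refl])
  thus ?thesis
    using neg_binomial_cong[OF nz, of n "m i"] by (rule cong_trans)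
qed

lemma drazin_poly_cong_local_1:
  assumes "s \<ge> 1"
  shows "[drazin_poly n = 0] (mod u 1 ^ m 1)"
  unfolding cong_0_iff drazin_poly_def
  by (intro dvd_sum dvd_smult)
    (use assms L_cong_other[of 1] in \<open>auto simp: cong_0_iff\<close>)

end

locale factored_poly_with_zero = factored_poly +
  assumes s: "s \<ge> 1" and zero: "\<alpha> 1 = 0" and m_pos: "\<And>j. j \<in> {2..s} \<Longrightarrow> m j \<ge> 1"
begin

text \<open>
  Each identity below says something trivial at \<open>\<alpha> 1 = 0\<close>, where \<open>drazin_poly\<close> vanishes, and is at
  the other roots a consequence of \<open>drazin_poly n\<close> being inverse to \<open>x\<^sup>n\<close>. This rule packages that
  case distinction.
\<close>

lemma cong_P_cases:
  assumes "[p = q] (mod u 1 ^ m 1)"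
    and "\<And>i. \<lbrakk>i \<in> {2..s}; \<And>n. [[:0, 1:] ^ n * drazin_poly n = 1] (mod u i ^ m i)\<rbrakk>
            \<Longrightarrow> [p = q] (mod u i ^ m i)"
  shows "[p = q] (mod P)"
proof (rule cong_P_if_cong_local)
  fix j assume j: "j \<in> {1..s}"
  show "[p = q] (mod u j ^ m j)"
  proof (cases "j = 1")
    case False
    with j have j2: "j \<in> {2..s}" by auto
    have "\<alpha> j \<noteq> 0"
      using inj_onD[OF inj, of j 1] zero j False s by auto
    with j2 show ?thesis
      using drazin_poly_cong_local m_pos assms(2) by blast
  qed (use assms in simp)
qed

lemma drazin_poly_outer_inverse: "[drazin_poly 1 * [:0, 1:] * drazin_poly 1 = drazin_poly 1] (mod P)"
proof (rule cong_P_cases)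
  show "[drazin_poly 1 * [:0, 1:] * drazin_poly 1 = drazin_poly 1] (mod u 1 ^ m 1)"
    using cong_mult[OF cong_refl drazin_poly_cong_local_1[OF s, of 1], of "drazin_poly 1 * [:0, 1:]"]
    unfolding mult_zero_right by (rule cong_trans[OF _ cong_sym]) (rule drazin_poly_cong_local_1[OF s])
next
  fix i assume "\<And>n. [[:0, 1:] ^ n * drazin_poly n = 1] (mod u i ^ m i)"
  from cong_mult[OF cong_refl this[of 1], of "drazin_poly 1"]
  show "[drazin_poly 1 * [:0, 1:] * drazin_poly 1 = drazin_poly 1] (mod u i ^ m i)"
    by (simp only: power_one_right mult.assoc mult_1_right)
qed

lemma drazin_poly_inverse_on_power: "[[:0, 1:] ^ (m 1 + 1) * drazin_poly 1 = [:0, 1:] ^ m 1] (mod P)"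
proof (rule cong_P_cases)
  have "[:0, 1:] ^ m 1 dvd [:0, 1:] ^ (m 1 + 1) * drazin_poly 1 - [:0, 1:] ^ m 1"
    by (intro dvd_diff dvd_mult2 le_imp_power_dvd dvd_refl) simp
  thus "[[:0, 1:] ^ (m 1 + 1) * drazin_poly 1 = [:0, 1:] ^ m 1] (mod u 1 ^ m 1)"
    by (simp only: cong_iff_dvd_diff zero minus_zero)
next
  fix i assume "\<And>n. [[:0, 1:] ^ n * drazin_poly n = 1] (mod u i ^ m i)"
  from cong_mult[OF cong_refl this[of 1], of "[:0, 1:] ^ m 1"]
  show "[[:0, 1:] ^ (m 1 + 1) * drazin_poly 1 = [:0, 1:] ^ m 1] (mod u i ^ m i)"
    by (simp only: power_one_right mult.assoc mult_1_right power_add)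
qed

lemma drazin_poly_power:
  assumes "n \<ge> 1"
  shows "[drazin_poly 1 ^ n = drazin_poly n] (mod P)"
proof (rule cong_P_cases)
  have "[drazin_poly 1 ^ n = 0 ^ n] (mod u 1 ^ m 1)"
    by (intro cong_pow drazin_poly_cong_local_1 s)
  also have "0 ^ n = (0 :: complex poly)" using assms by simp
  finally show "[drazin_poly 1 ^ n = drazin_poly n] (mod u 1 ^ m 1)"
    using drazin_poly_cong_local_1[OF s, of n] by (rule cong_trans[OF _ cong_sym])
next
  let ?X = "[:0, 1:] :: complex poly"
  fix i assume Q: "\<And>n. [?X ^ n * drazin_poly n = 1] (mod u i ^ m i)"
  \<comment> \<open>both \<open>drazin_poly n\<close> and \<open>drazin_poly 1 ^ n\<close> are inverse to \<open>x\<^sup>n\<close>, hence congruent\<close>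
  have "[(?X ^ 1 * drazin_poly 1) ^ n = 1 ^ n] (mod u i ^ m i)"
    by (rule cong_pow[OF Q])
  hence "[drazin_poly n * (?X ^ n * drazin_poly 1 ^ n) = drazin_poly n * 1] (mod u i ^ m i)"
    by (intro cong_mult[OF cong_refl]) (simp only: power_mult_distrib power_one power_one_right)
  moreover have "[drazin_poly 1 ^ n * (?X ^ n * drazin_poly n) = drazin_poly 1 ^ n * 1] (mod u i ^ m i)"
    by (intro cong_mult[OF cong_refl] Q)
  moreover have "drazin_poly n * (?X ^ n * drazin_poly 1 ^ n) = drazin_poly 1 ^ n * (?X ^ n * drazin_poly n)"
    by (simp only: mult_ac)
  ultimately show "[drazin_poly 1 ^ n = drazin_poly n] (mod u i ^ m i)"
    by (simp only: cong_def mult_1_right)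
qed

end

section \<open>Kernels of powers and diagonalizability\<close>

lemma mat_kernel_pow_Suc:
  assumes "M \<in> carrier_mat n n"
  shows "mat_kernel (M ^\<^sub>m r) \<subseteq> mat_kernel (M ^\<^sub>m (r + 1))"
proof -
  have "M ^\<^sub>m (r + 1) = M * M ^\<^sub>m r"
    using square_matrix.pow_mat_commute[of M n r] assms by (simp add: square_matrix_def)
  thus ?thesis
    using mat_kernel_mult_subset[of "M ^\<^sub>m r" n n M n] assms by simp
qed

lemma mult_mat_zero_vec: "M \<in> carrier_mat nr nc \<Longrightarrow> M *\<^sub>v 0\<^sub>v nc = 0\<^sub>v nr"
  by (intro eq_vecI) auto

lemma mult_diagonal_mat_vec:
  assumes "E \<in> carrier_mat n n" "diagonal_mat E" "v \<in> carrier_vec n" "i < n"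
  shows "(E *\<^sub>v v) $ i = E $$ (i, i) * v $ i"
proof -
  have "(E *\<^sub>v v) $ i = (\<Sum>j<n. E $$ (i, j) * v $ j)"
    using assms by (simp add: scalar_prod_def atLeast0LessThan)
  also have "\<dots> = (\<Sum>j<n. if j = i then E $$ (i, i) * v $ i else 0)"
    using assms by (intro sum.cong) (auto simp: diagonal_mat_def)
  finally show ?thesis using assms by simp
qed

lemma diagonal_char_matrix:
  "diagonal_mat D \<Longrightarrow> D \<in> carrier_mat n n \<Longrightarrow> diagonal_mat (char_matrix D a)"
  by (auto simp: diagonal_mat_def char_matrix_def)

text \<open>
  For a diagonal matrix \<open>E\<close>, both \<open>E w = 0\<close> and \<open>E\<^sup>2 w = 0\<close> mean that \<open>w\<close> is supported where the
  diagonal of \<open>E\<close> vanishes; the general case follows by a change of basis.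
\<close>

lemma mat_kernel_char_matrix_if_diagonalizable:
  assumes A: "A \<in> carrier_mat n n" and diag: "diagonalizable_mat A"
  shows "mat_kernel (char_matrix A a ^\<^sub>m 1) = mat_kernel (char_matrix A a ^\<^sub>m (1 + 1))"
proof (rule subset_antisym[OF mat_kernel_pow_Suc subsetI])
  show "char_matrix A a \<in> carrier_mat n n" using A by simp
  fix v assume v: "v \<in> mat_kernel (char_matrix A a ^\<^sub>m (1 + 1))"
  let ?C = "char_matrix A a"
  have C: "?C ^\<^sub>m r \<in> carrier_mat n n" for r using A by simp
  from diag obtain D S T where D: "diagonal_mat D" and wit: "similar_mat_wit A D S T"
    by (auto simp: diagonalizable_mat_def similar_mat_def)
  from similar_mat_witD2[OF A wit] have ST: "S \<in> carrier_mat n n" "T \<in> carrier_mat n n"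
      "T * S = 1\<^sub>m n" and Dc: "D \<in> carrier_mat n n" by auto
  define E where "E = char_matrix D a"
  have E: "E \<in> carrier_mat n n" "diagonal_mat E"
    using Dc D diagonal_char_matrix by (auto simp: E_def)
  have pow: "?C ^\<^sub>m r = S * E ^\<^sub>m r * T" for r
    unfolding E_def by (rule similar_mat_wit_pow_id[OF similar_mat_wit_char_matrix[OF wit]])
  have vc: "v \<in> carrier_vec n" and v0: "?C ^\<^sub>m (1 + 1) *\<^sub>v v = 0\<^sub>v n"
    using mat_kernelD[OF C v] by auto
  define w where "w = T *\<^sub>v v"
  have w: "w \<in> carrier_vec n" using ST vc by (simp add: w_def)
  have "E *\<^sub>v (E *\<^sub>v w) = (T * S) *\<^sub>v (E *\<^sub>v (E *\<^sub>v w))"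
    by (subst ST(3)) (use E w in simp)
  also have "\<dots> = T *\<^sub>v (?C ^\<^sub>m (1 + 1) *\<^sub>v v)"
    unfolding pow w_def using ST(1,2) E vc by (simp add: assoc_mult_mat_vec[of _ n n _ n])
  also have "\<dots> = 0\<^sub>v n" unfolding v0 by (rule mult_mat_zero_vec[OF ST(2)])
  finally have EE: "E *\<^sub>v (E *\<^sub>v w) = 0\<^sub>v n" .
  have "E *\<^sub>v w = 0\<^sub>v n"
  proof (rule eq_vecI)
    fix i assume "i < dim_vec (0\<^sub>v n)"
    hence i: "i < n" by simp
    have "E $$ (i, i) * (E $$ (i, i) * w $ i) = (E *\<^sub>v (E *\<^sub>v w)) $ i"
      using mult_diagonal_mat_vec[OF E _ i] w E by simp
    also have "\<dots> = 0" using EE i by simp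
    finally show "(E *\<^sub>v w) $ i = 0\<^sub>v n $ i"
      using mult_diagonal_mat_vec[OF E w i] i by simp
  qed (use E in simp)
  hence "?C ^\<^sub>m 1 *\<^sub>v v = 0\<^sub>v n"
    unfolding pow using ST E vc by (simp add: assoc_mult_mat_vec[of _ n n _ n] w_def mult_mat_zero_vec)
  thus "v \<in> mat_kernel (?C ^\<^sub>m 1)"
    by (intro mat_kernelI[OF C vc])
qed

lemma diagonal_jordan_matrix:
  assumes "\<And>n a. (n, a) \<in> set n_as \<Longrightarrow> n \<le> 1"
  shows "diagonal_mat (jordan_matrix n_as)"
  using assms
proof (induction n_as)
  case Nil
  thus ?case by (simp add: jordan_matrix_def diagonal_mat_def)
next
  case (Cons na n_as)
  obtain n a where na: "na = (n, a)" by force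
  have "n \<le> 1" using Cons.prems na by auto
  moreover have "diagonal_mat (jordan_matrix n_as)" using Cons by auto
  ultimately show ?case
    unfolding na jordan_matrix_Cons
    by (auto simp: diagonal_mat_def)
qed

text \<open>
  The dimension of the kernel of \<open>(A - a I)\<^sup>r\<close> is the sum of \<open>min r l\<close> over the sizes \<open>l\<close> of the
  Jordan blocks for \<open>a\<close>. Passing from \<open>r = 1\<close> to \<open>r = 2\<close> leaves this sum unchanged only if all
  blocks have size one.
\<close>

lemma diagonalizable_if_mat_kernel_char_matrix:
  fixes A :: "complex mat"
  assumes A: "A \<in> carrier_mat n n"
    and ker: "\<And>a. eigenvalue A a \<Longrightarrow>
        mat_kernel (char_matrix A a ^\<^sub>m 1) = mat_kernel (char_matrix A a ^\<^sub>m (1 + 1))"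
  shows "diagonalizable_mat A"
proof -
  obtain n_as where J: "jordan_nf A n_as"
    using char_poly_factorized[OF A] jordan_nf_exists[OF A] by blast
  have "l \<le> 1" if la: "(l, a) \<in> set n_as" for l a
  proof (rule ccontr)
    assume "\<not> l \<le> 1"
    define ls where "ls = map fst [(n, e)\<leftarrow>n_as . e = a]"
    have "poly (char_poly A) a = 0"
      unfolding jordan_nf_char_poly[OF J] poly_prod_list prod_list_zero_iff
      using la \<open>\<not> l \<le> 1\<close> by (force simp: image_iff)
    hence "eigenvalue A a" by (simp add: eigenvalue_root_char_poly[OF A])
    from ker[OF this] A have "dim_gen_eigenspace A a 1 = dim_gen_eigenspace A a (1 + 1)"
      by (simp add: dim_gen_eigenspace_def kernel_dim_def)
    hence eq: "(\<Sum>n\<leftarrow>ls. min 1 n) = (\<Sum>n\<leftarrow>ls. min (1 + 1) n)"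
      unfolding dim_gen_eigenspace[OF J] ls_def .
    have "l \<in> set ls" using la by (force simp: ls_def)
    then obtain xs ys where "ls = xs @ l # ys" by (meson split_list)
    moreover have mono: "(\<Sum>n\<leftarrow>zs. min 1 n) \<le> (\<Sum>n\<leftarrow>zs. min (1 + 1) n)" for zs :: "nat list"
      by (rule sum_list_mono) simp
    have "(\<Sum>n\<leftarrow>xs. min 1 n) \<le> (\<Sum>n\<leftarrow>xs. min (1 + 1) n)"
      and "(\<Sum>n\<leftarrow>ys. min 1 n) \<le> (\<Sum>n\<leftarrow>ys. min (1 + 1) n)"
      by (rule mono)+
    ultimately show False using eq \<open>\<not> l \<le> 1\<close> by simp
  qed
  hence "diagonal_mat (jordan_matrix n_as)" by (rule diagonal_jordan_matrix)
  with J show ?thesis by (auto simp: diagonalizable_mat_def jordan_nf_def)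
qed

section \<open>Uniqueness of the Drazin inverse\<close>

text \<open>
  A Drazin inverse \<open>V\<close> satisfies \<open>V = A V\<^sup>2 = V\<^sup>2 A\<close>, so it is divisible by every power of \<open>A\<close> on
  either side. Since \<open>X A\<close> acts as the identity on high powers of \<open>A\<close> this yields \<open>X A Y = Y\<close>, and
  symmetrically \<open>X A Y = X\<close>.
\<close>

lemma drazin_inverse_unique:
  assumes A: "A \<in> carrier_mat n n" and X: "is_drazin_inverse A X" and Y: "is_drazin_inverse A Y"
  shows "X = Y"
proof -
  note assoc = assoc_mult_mat[of _ n n _ n _ n]
  have left: "\<exists>W\<in>carrier_mat n n. V = A ^\<^sub>m i * W" and right: "\<exists>W\<in>carrier_mat n n. V = W * A ^\<^sub>m i"
    and comm: "A ^\<^sub>m i * V = V * A ^\<^sub>m i" and carr: "V \<in> carrier_mat n n"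
    if V: "is_drazin_inverse A V" for V i
  proof -
    from V A have V: "V \<in> carrier_mat n n" "A * V = V * A" "V * A * V = V"
      by (auto simp: is_drazin_inverse_def)
    show "V \<in> carrier_mat n n" by fact
    have "V = (A * V) * V" using V(3) unfolding V(2) by (rule sym)
    also have "\<dots> = A * (V * V)" using V(1) A by (intro assoc)
    finally have AVV: "V = A * (V * V)" .
    have "V = V * (A * V)" using V(3) assoc[OF V(1) A V(1)] by simp
    also have "\<dots> = (V * V) * A" unfolding V(2) using V(1) A by (intro assoc[symmetric])
    finally have VVA: "V = (V * V) * A" .
    show "\<exists>W\<in>carrier_mat n n. V = A ^\<^sub>m i * W"
    proof (induction i)
      case (Suc i)
      then obtain W where W: "W \<in> carrier_mat n n" "V = A ^\<^sub>m i * W" by blast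
      have "V = A * (V * V)" by (fact AVV)
      also have "\<dots> = A * (A ^\<^sub>m i * W * V)" by (rule arg_cong[OF W(2), of "\<lambda>M. A * (M * V)"])
      also have "\<dots> = (A * A ^\<^sub>m i) * (W * V)" using W(1) A V(1) by (simp add: assoc)
      also have "A * A ^\<^sub>m i = A ^\<^sub>m Suc i"
        using square_matrix.pow_mat_commute[of A n i] A by (simp add: square_matrix_def)
      finally show ?case using mult_carrier_mat[OF W(1) V(1)] by (rule bexI)
    qed (use V(1) A in auto)
    show "\<exists>W\<in>carrier_mat n n. V = W * A ^\<^sub>m i"
    proof (induction i)
      case (Suc i)
      then obtain W where W: "W \<in> carrier_mat n n" "V = W * A ^\<^sub>m i" by blast
      have "V = (V * V) * A" by (fact VVA)
      also have "\<dots> = (V * (W * A ^\<^sub>m i)) * A" by (rule arg_cong[OF W(2), of "\<lambda>M. V * M * A"])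
      also have "\<dots> = (V * W) * A ^\<^sub>m Suc i"
        using W(1) A V(1) mult_carrier_mat[of "A ^\<^sub>m i" n n A n] by (simp add: assoc)
      finally show ?case using mult_carrier_mat[OF V(1) W(1)] by (rule bexI)
    qed (use V(1) A in auto)
    show "A ^\<^sub>m i * V = V * A ^\<^sub>m i"
    proof (induction i)
      case (Suc i)
      have "A ^\<^sub>m Suc i * V = A ^\<^sub>m i * (V * A)" using V(1,2) A by (simp add: assoc)
      also have "\<dots> = (A ^\<^sub>m i * V) * A" using V(1) A by (simp add: assoc)
      also have "\<dots> = V * A ^\<^sub>m Suc i" unfolding Suc using V(1) A by (simp add: assoc)
      finally show ?case .
    qed (use V(1) A in auto)
  qed
  have Xc: "X \<in> carrier_mat n n" and Yc: "Y \<in> carrier_mat n n" using carr X Y by auto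
  have Ac: "A ^\<^sub>m i \<in> carrier_mat n n" for i using A by simp
  have Suc_pow: "A * A ^\<^sub>m i = A ^\<^sub>m (i + 1)" for i
    using square_matrix.pow_mat_commute[of A n i] A by (simp add: square_matrix_def)
  obtain l l' where l: "A ^\<^sub>m (l + 1) * X = A ^\<^sub>m l" and l': "A ^\<^sub>m (l' + 1) * Y = A ^\<^sub>m l'"
    using X Y by (auto simp: is_drazin_inverse_def)
  obtain W where W: "W \<in> carrier_mat n n" "Y = A ^\<^sub>m l * W" using left[OF Y] by blast
  obtain W' where W': "W' \<in> carrier_mat n n" "X = W' * A ^\<^sub>m l'" using right[OF X] by blast
  have "X * (A * Y) = X * (A * (A ^\<^sub>m l * W))" by (rule arg_cong[OF W(2)])
  also have "\<dots> = X * A ^\<^sub>m (l + 1) * W"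
    using Xc A W(1) Ac[of l] unfolding Suc_pow[symmetric] by (simp add: assoc)
  also have "X * A ^\<^sub>m (l + 1) = A ^\<^sub>m l" using comm[OF X, of "l + 1"] unfolding l by (rule sym)
  finally have XAY_Y: "X * (A * Y) = Y" unfolding W(2)[symmetric] .
  have "X * (A * Y) = W' * A ^\<^sub>m l' * (A * Y)" by (rule arg_cong[OF W'(2)])
  also have "\<dots> = W' * (A ^\<^sub>m (l' + 1) * Y)"
    using Yc A W'(1) Ac[of l'] by (simp add: assoc)
  finally have "X * (A * Y) = X" unfolding l' W'(2)[symmetric] .
  with XAY_Y show ?thesis by simp
qed

section \<open>Spectral data read off from the matrices \<open>L\<^sub>j\<^sub>r(A)\<close>\<close>

locale spectral = factored_poly + square_matrix A k for A :: "complex mat" and k +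
  assumes char_poly: "char_poly A = P"
begin

lemma poly_mat_cong:
  assumes "[p = q] (mod P)"
  shows "Z p = Z q"
proof -
  obtain w where "p - q = P * w"
    using assms unfolding cong_iff_dvd_diff by (rule dvdE)
  hence "p = q + P * w" by (simp only: algebra_simps)
  hence "Z p = Z q + Z (char_poly A) * Z w"
    by (simp add: poly_mat_add poly_mat_mult char_poly)
  thus ?thesis by (simp add: cayley_hamilton)
qed

lemma poly_mat_u: "Z (u i) = char_matrix A (\<alpha> i)"
  by (rule eq_matI) (auto simp: poly_mat_pCons char_matrix_def)

lemma mem_mat_kernel_char_matrix_pow:
  "v \<in> mat_kernel (char_matrix A (\<alpha> i) ^\<^sub>m n) \<longleftrightarrow> v \<in> carrier_vec k \<and> Z (u i ^ n) *\<^sub>v v = 0\<^sub>v k"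
  by (simp add: poly_mat_u[symmetric] poly_mat_power[symmetric] mat_kernel[of _ k k])

text \<open>
  If the kernels agree at \<open>r\<close>, a factor \<open>u i\<close> can be removed from \<open>u i ^ t * L i 0\<close>, as long as
  \<open>t > r\<close>, without changing whether its value at \<open>A\<close> is zero; starting from a large \<open>t\<close>, where
  \<open>L i t\<close> vanishes, this leads down to \<open>t = r\<close>. Conversely \<open>u i\<close> divides \<open>1 - L i 0\<close>, so \<open>u i ^ r\<close> is a
  combination of \<open>L i r\<close> and \<open>u i ^ (r + 1)\<close> modulo \<open>P\<close>; when \<open>L i r\<close> vanishes at \<open>A\<close>, whatever is killed
  by \<open>(A - \<alpha> i I)\<^bsup>r+1\<^esup>\<close> is killed by \<open>(A - \<alpha> i I)\<^sup>r\<close>.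
\<close>

lemma mat_kernel_stable_iff:
  assumes i: "i \<in> {1..s}" and m: "m i \<ge> 1"
  shows "mat_kernel (char_matrix A (\<alpha> i) ^\<^sub>m r) = mat_kernel (char_matrix A (\<alpha> i) ^\<^sub>m (r + 1))
      \<longleftrightarrow> Z (L i r) = 0\<^sub>m k k"
    (is "?ker r = ?ker (r + 1) \<longleftrightarrow> _")
proof
  assume stable: "?ker r = ?ker (r + 1)"
  have step: "Z (u i ^ r * p) = 0\<^sub>m k k" if p: "Z (u i ^ (r + 1) * p) = 0\<^sub>m k k" for p
  proof (rule mat_col_eqI)
    fix j assume "j < dim_col (0\<^sub>m k k :: complex mat)"
    hence j: "j < k" by simp
    have c: "col (Z p) j \<in> carrier_vec k" using j by (auto simp: col_def)
    have col: "Z f *\<^sub>v col (Z p) j = col (Z (f * p)) j" for f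
      using j by (simp add: poly_mat_mult col_mult2[of _ k k _ k])
    have "col (Z p) j \<in> ?ker (r + 1)"
      unfolding mem_mat_kernel_char_matrix_pow col p using c j by simp
    hence "col (Z p) j \<in> ?ker r" by (simp only: stable)
    thus "col (Z (u i ^ r * p)) j = col (0\<^sub>m k k) j"
      unfolding mem_mat_kernel_char_matrix_pow col using j by simp
  qed simp_all
  have "Z (u i ^ (r + d) * L i 0) = 0\<^sub>m k k \<Longrightarrow> Z (u i ^ r * L i 0) = 0\<^sub>m k k" for d
  proof (induction d)
    case (Suc d)
    have "Z (u i ^ (r + 1) * (u i ^ d * L i 0)) = 0\<^sub>m k k"
      using Suc.prems by (simp only: mult.assoc[symmetric] power_add[symmetric] add_Suc add_Suc_right
        Suc_eq_plus1[symmetric])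
    from step[OF this] have "Z (u i ^ (r + d) * L i 0) = 0\<^sub>m k k"
      by (simp only: mult.assoc[symmetric] power_add[symmetric])
    thus ?case by (rule Suc.IH)
  qed simp
  moreover have "Z (u i ^ (r + m i) * L i 0) = 0\<^sub>m k k"
  proof -
    have "L i (r + m i) = 0" by (simp add: L_poly_def)
    thus ?thesis
      using poly_mat_cong[OF L_cong_power_mult[OF i, of "r + m i"]] by simp
  qed
  ultimately show "Z (L i r) = 0\<^sub>m k k"
    using poly_mat_cong[OF L_cong_power_mult[OF i, of r]] by simp
next
  assume L0: "Z (L i r) = 0\<^sub>m k k"
  have "u i dvd u i ^ m i" using m by (intro dvd_power) simp
  moreover have "u i ^ m i dvd 1 - L i 0"
    using L_cong_self[OF i, of 0] by (simp add: cong_iff_dvd_diff dvd_diff_commute)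
  ultimately obtain q where q: "1 - L i 0 = u i * q"
    by (meson dvd_trans dvd_def)
  have "u i ^ r = u i ^ r * L i 0 + q * u i ^ (r + 1)"
  proof -
    have "u i ^ r = u i ^ r * L i 0 + u i ^ r * (1 - L i 0)"
      by (simp only: right_diff_distrib mult_1_right) simp
    thus ?thesis
      unfolding q by (simp only: power_add power_one_right mult_ac)
  qed
  hence "Z (u i ^ r) = Z (u i ^ r * L i 0) + Z q * Z (u i ^ (r + 1))"
    by (metis poly_mat_add poly_mat_mult)
  also have "Z (u i ^ r * L i 0) = 0\<^sub>m k k"
    using poly_mat_cong[OF L_cong_power_mult[OF i, of r]] L0 by simp
  finally have "Z (u i ^ r) = Z q * Z (u i ^ (r + 1))"
    by (simp add: left_add_zero_mat[of _ k k] poly_mat_mult[symmetric] del: power_Suc)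
  hence "?ker (r + 1) \<subseteq> ?ker r"
    using mat_kernel_mult_subset[of "Z (u i ^ (r + 1))" k k "Z q" k]
    by (simp only: poly_mat_u[symmetric] poly_mat_power[symmetric] poly_mat_carrier)
  moreover have "?ker r \<subseteq> ?ker (r + 1)"
    by (rule mat_kernel_pow_Suc) (rule char_matrix_closed[OF carrier_A])
  ultimately show "?ker r = ?ker (r + 1)" by blast
qed

lemma poly_mat_L_eq_0_mono:
  assumes i: "i \<in> {1..s}" and "Z (L i r) = 0\<^sub>m k k" "r \<le> t"
  shows "Z (L i t) = 0\<^sub>m k k"
proof -
  have "Z (L i t) = Z (u i ^ (t - r) * (u i ^ r * L i 0))"
    using poly_mat_cong[OF L_cong_power_mult[OF i, of t]] assms
    by (simp add: mult.assoc[symmetric] power_add[symmetric])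
  also have "\<dots> = Z (u i ^ (t - r)) * Z (L i r)"
    using poly_mat_cong[OF L_cong_power_mult[OF i, of r]] by (simp only: poly_mat_mult)
  finally show ?thesis using assms by simp
qed

lemma eigenvalue_iff: "eigenvalue A a \<longleftrightarrow> (\<exists>i\<in>{1..s}. m i \<ge> 1 \<and> a = \<alpha> i)"
  unfolding eigenvalue_root_char_poly[OF carrier_A] char_poly
  by (auto simp: poly_prod Suc_le_eq)

text \<open>
  Otherwise the kernels of the powers of \<open>A - \<alpha> i I\<close> would be stationary from the power \<open>0\<close> on, that is,
  trivial, although \<open>\<alpha> i\<close> is an eigenvalue.
\<close>

lemma poly_mat_L_0_nonzero:
  assumes i: "i \<in> {1..s}" and m: "m i \<ge> 1"
  shows "Z (L i 0) \<noteq> 0\<^sub>m k k"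
proof
  assume "Z (L i 0) = 0\<^sub>m k k"
  hence "mat_kernel (char_matrix A (\<alpha> i) ^\<^sub>m 0) = mat_kernel (char_matrix A (\<alpha> i) ^\<^sub>m (0 + 1))"
    by (subst mat_kernel_stable_iff[OF i m])
  moreover obtain v where "eigenvector A v (\<alpha> i)"
    using eigenvalue_iff[of "\<alpha> i"] i m by (auto simp: eigenvalue_def)
  hence v: "v \<in> carrier_vec k" "v \<noteq> 0\<^sub>v k" "char_matrix A (\<alpha> i) *\<^sub>v v = 0\<^sub>v k"
    by (auto simp: eigenvector_char_matrix[OF carrier_A])
  hence "v \<in> mat_kernel (char_matrix A (\<alpha> i) ^\<^sub>m (0 + 1))"
    using mat_kernelI[of "char_matrix A (\<alpha> i)" k k v] char_matrix_closed[OF carrier_A, of "\<alpha> i"]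
    by simp
  ultimately have "v \<in> mat_kernel (char_matrix A (\<alpha> i) ^\<^sub>m 0)" by simp
  hence "v \<in> mat_kernel (1\<^sub>m k)"
    using char_matrix_closed[OF carrier_A, of "\<alpha> i"] by simp
  hence "1\<^sub>m k *\<^sub>v v = 0\<^sub>v k"
    using mat_kernelD[of "1\<^sub>m k" k k v] by simp
  with v show False by simp
qed

lemma eigenvalue_index_eq_Least:
  assumes "i \<in> {1..s}" "m i \<ge> 1"
  shows "eigenvalue_index A (\<alpha> i) = (LEAST r. r \<ge> 1 \<and> Z (L i r) = 0\<^sub>m k k)"
  unfolding eigenvalue_index_def mat_kernel_stable_iff[OF assms] ..

lemma
  assumes i: "i \<in> {1..s}" and m: "m i \<ge> 1"
  shows eigenvalue_index_ge_1: "eigenvalue_index A (\<alpha> i) \<ge> 1"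
    and poly_mat_L_eq_0_iff: "Z (L i r) = 0\<^sub>m k k \<longleftrightarrow> eigenvalue_index A (\<alpha> i) \<le> r"
proof -
  let ?R = "\<lambda>r. r \<ge> 1 \<and> Z (L i r) = 0\<^sub>m k k"
  have "L i (m i) = 0" by (simp add: L_poly_def)
  with m have "?R (m i)" by simp
  hence R: "?R (eigenvalue_index A (\<alpha> i))"
    unfolding eigenvalue_index_eq_Least[OF i m] by (rule LeastI)
  thus "eigenvalue_index A (\<alpha> i) \<ge> 1" by simp
  show "Z (L i r) = 0\<^sub>m k k \<longleftrightarrow> eigenvalue_index A (\<alpha> i) \<le> r"
  proof
    assume Z: "Z (L i r) = 0\<^sub>m k k"
    hence "r \<noteq> 0" using poly_mat_L_0_nonzero[OF i m] by metis
    with Z show "eigenvalue_index A (\<alpha> i) \<le> r"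
      unfolding eigenvalue_index_eq_Least[OF i m] by (intro Least_le) simp
  qed (use R poly_mat_L_eq_0_mono[OF i] in blast)
qed

lemma diagonalizable_iff:
  "diagonalizable_mat A \<longleftrightarrow> (\<forall>i\<in>{1..s}. Z (L i 1) = 0\<^sub>m k k)"
proof
  assume diag: "diagonalizable_mat A"
  show "\<forall>i\<in>{1..s}. Z (L i 1) = 0\<^sub>m k k"
  proof
    fix i assume i: "i \<in> {1..s}"
    show "Z (L i 1) = 0\<^sub>m k k"
    proof (cases "m i \<ge> 1")
      case True
      thus ?thesis
        using mat_kernel_char_matrix_if_diagonalizable[OF carrier_A diag]
          mat_kernel_stable_iff[OF i] by metis
    qed (simp add: L_poly_def)
  qed
next
  assume L: "\<forall>i\<in>{1..s}. Z (L i 1) = 0\<^sub>m k k"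
  show "diagonalizable_mat A"
  proof (rule diagonalizable_if_mat_kernel_char_matrix[OF carrier_A])
    fix a assume "eigenvalue A a"
    then obtain i where "i \<in> {1..s}" "m i \<ge> 1" "a = \<alpha> i" by (auto simp: eigenvalue_iff)
    thus "mat_kernel (char_matrix A a ^\<^sub>m 1) = mat_kernel (char_matrix A a ^\<^sub>m (1 + 1))"
      using L mat_kernel_stable_iff by metis
  qed
qed

end

locale spectral_with_zero = spectral + factored_poly_with_zero
begin

lemma drazin_inverse_eq: "drazin_inverse A = Z (drazin_poly 1)"
proof -
  have D: "is_drazin_inverse A (Z (drazin_poly 1))"
    unfolding is_drazin_inverse_def
  proof (intro conjI exI)
    show "A * Z (drazin_poly 1) = Z (drazin_poly 1) * A"
      by (metis poly_mat_X poly_mat_mult mult.commute)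
    show "Z (drazin_poly 1) * A * Z (drazin_poly 1) = Z (drazin_poly 1)"
      using poly_mat_cong[OF drazin_poly_outer_inverse] by (simp only: poly_mat_mult poly_mat_X)
    show "A ^\<^sub>m (m 1 + 1) * Z (drazin_poly 1) = A ^\<^sub>m m 1"
      using poly_mat_cong[OF drazin_poly_inverse_on_power]
      by (simp only: poly_mat_mult poly_mat_X poly_mat_power)
  qed simp
  thus ?thesis
    unfolding drazin_inverse_def
    by (rule the_equality) (rule drazin_inverse_unique[OF carrier_A _ D])
qed

lemma drazin_inverse_power:
  assumes "n \<ge> 1"
  shows "drazin_inverse A ^\<^sub>m n = (\<Oplus>\<^bsub>module_mat TYPE(complex) k k\<^esub>i\<in>{2..s}.
           \<Oplus>\<^bsub>module_mat TYPE(complex) k k\<^esub>j\<in>{0..m i - 1}.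
             (((- of_nat n) gchoose j) * \<alpha> i powi (- int n - int j)) \<cdot>\<^sub>m Z (L i j))"
proof -
  have "drazin_inverse A ^\<^sub>m n = Z (drazin_poly n)"
    unfolding drazin_inverse_eq poly_mat_power[symmetric]
    by (rule poly_mat_cong[OF drazin_poly_power[OF assms]])
  thus ?thesis by (simp only: drazin_poly_def poly_mat_sum finite_atLeastAtMost poly_mat_smult)
qed

end

theorem theorem3p5:
  fixes A :: "complex mat" and k s :: nat
    and \<alpha> :: "nat \<Rightarrow> complex" and m :: "nat \<Rightarrow> nat"
    and B :: "nat \<Rightarrow> nat \<Rightarrow> complex mat"
  assumes "k \<ge> 1" and "A \<in> carrier_mat k k"
    and "s \<ge> 1" and "inj_on \<alpha> {1..s}" and "\<alpha> 1 = 0"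
    and "\<forall>j\<in>{2..s}. m j \<ge> 1"
    and "char_poly A = (\<Prod>i=1..s. [:- \<alpha> i, 1:] ^ m i)"
    and "\<forall>i r. B i r = poly_mat (L_poly s \<alpha> m i r) A"
  shows
    "(\<forall>i\<in>{1..s}. m i \<ge> 1 \<longrightarrow>
        eigenvalue_index A (\<alpha> i) \<ge> 1 \<and>
        B i (eigenvalue_index A (\<alpha> i) - 1) \<noteq> 0\<^sub>m k k \<and>
        (\<forall>j\<ge>1. B i (j - 1) \<noteq> 0\<^sub>m k k \<longrightarrow> j \<le> eigenvalue_index A (\<alpha> i))) \<and>
     (\<forall>i\<in>{1..s}. m i \<ge> 1 \<longrightarrow> (eigenvalue_index A (\<alpha> i) = 1 \<longleftrightarrow> B i 1 = 0\<^sub>m k k)) \<and>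
     (diagonalizable_mat A \<longleftrightarrow> (\<forall>i\<in>{1..s}. B i 1 = 0\<^sub>m k k)) \<and>
     (\<forall>n\<ge>1. drazin_inverse A ^\<^sub>m n =
        (\<Oplus>\<^bsub>module_mat TYPE(complex) k k\<^esub>i\<in>{2..s}.
           \<Oplus>\<^bsub>module_mat TYPE(complex) k k\<^esub>j\<in>{0..m i - 1}.
             (((- of_nat n) gchoose j) * \<alpha> i powi (- int n - int j)) \<cdot>\<^sub>m B i j))"
proof -
  interpret spectral_with_zero s \<alpha> m A k
    using assms by unfold_locales auto
  have B: "B i r = Z (L i r)" for i r using assms by blast
  show ?thesis
    unfolding B
  proof (intro conjI ballI impI allI)
    fix i assume i: "i \<in> {1..s}" "m i \<ge> 1"
    show ge: "eigenvalue_index A (\<alpha> i) \<ge> 1"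
      by (rule eigenvalue_index_ge_1[OF i])
    show "Z (L i (eigenvalue_index A (\<alpha> i) - 1)) \<noteq> 0\<^sub>m k k"
      using ge by (simp add: poly_mat_L_eq_0_iff[OF i])
    show "j \<le> eigenvalue_index A (\<alpha> i)" if "j \<ge> 1" "Z (L i (j - 1)) \<noteq> 0\<^sub>m k k" for j
      using that by (simp add: poly_mat_L_eq_0_iff[OF i])
    show "eigenvalue_index A (\<alpha> i) = 1 \<longleftrightarrow> Z (L i 1) = 0\<^sub>m k k"
      using ge by (auto simp: poly_mat_L_eq_0_iff[OF i])
  qed (rule diagonalizable_iff, rule drazin_inverse_power)
qed

end
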